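(* Let $\mathbb Y=(\mathbb F, \{{\bf y}_t\}_{t\in\mathbb T_n})$ be a positive ${\bf Y}$-space (associated with a $Y$-pattern $\{({\bf y}_t,B_t)\mid t\in\mathbb T_n\}$). Fix a $Y$-cluster ${\bf y}_{t_0}$, and let $M(t_0)\subseteq \mathcal U^{\rm mono}(\mathbb Y)$ denote the set of global monomials in ${\bf y}_{t_0}$, i.e. $M(t_0)=\{{\bf y}_{t_0}^{\bf h}\mid{\bf h}\in\mathbb Z^n,\ {\bf y}_{t_0}^{\bf h}\in\mathcal U(\mathbb Y)\}$. Then: (i) If $u$ is a global monomial on $\mathbb Y$ and $u\notin M(t_0)$, then no global monomial from ${\bf y}_{t_0}$ (i.e. no element of $M(t_0)$) appears with non-zero coefficient in the Laurent expansion of $u$ with respect to ${\bf y}_{t_0}$. (ii) The global monomials on $\mathbb Y$ are linearly independent over $\mathbb Z$.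
   Context: Fix a positive integer $n$, let $\mathbb F$ be the field of rational functions in $n$ variables over $\mathbb Q$, and $[a]_+=\max\{a,0\}$. Matrix mutation: for an $n\times n$ integer matrix $B=(b_{ij})$ and $1\le k\le n$, $\mu_k(B)=(b'_{ij})$ with $b'_{ij}=-b_{ij}$ if $i=k$ or $j=k$, and $b'_{ij}=b_{ij}+[b_{ik}]_+[b_{kj}]_+-[-b_{ik}]_+[-b_{kj}]_+$ otherwise. $B$ is skew-symmetrizable if $DB$ is skew-symmetric for some diagonal integer matrix $D$ with positive diagonal entries. A $Y$-seed in $\mathbb F$ is a pair $({\bf y},B)$ where ${\bf y}=(y_1,\ldots,y_n)$ is an ordered set of free generators of $\mathbb F$ over $\mathbb Q$ (the $Y$-cluster) and $B$ is an $n\times n$ skew-symmetrizable integer matrix. Its ${\bf Y}$-mutation in direction $k\in\{1,\ldots,n\}$ is $({\bf y}',B')=\mu_k({\bf y},B)$ with $B'=\mu_k(B)$, $y_k'=y_k^{-1}$, and $y_i'=y_iy_k^{[b_{ki}]_+}(1+y_k)^{-b_{ki}}$ for $i\ne k$. $\mathbb T_n$ is the $n$-regular tree with edges labeled by $1,\dots,n$ so that the $n$ edges at each vertex have different labels. A $Y$-pattern is an assignment of a $Y$-seed $({\bf y}_t,B_t)$ to each vertex $t$ of $\mathbb T_n$ such that $({\bf y}_{t'},B_{t'})=\mu_k({\bf y}_t,B_t)$ whenever $t,t'$ are joined by an edge labeled $k$. The associated positive ${\bf Y}$-space is the pair $\mathbb Y=(\mathbb F,\{{\bf y}_t\}_{t\in\mathbb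 T_n})$. Its coordinate algebra is $\mathcal U(\mathbb Y)=\bigcap_{t\in\mathbb T_n}\mathbb Z[y_{1;t}^{\pm1},\ldots,y_{n;t}^{\pm1}]$. A global monomial on $\mathbb Y$ is an element of $\mathcal U(\mathbb Y)$ of the form ${\bf y}_t^{\bf h}=y_{1;t}^{h_1}\cdots y_{n;t}^{h_n}$ for some $t\in\mathbb T_n$, ${\bf h}\in\mathbb Z^n$; $\mathcal U^{\rm mono}(\mathbb Y)$ is the set of all global monomials. The Laurent expansion of $u\in\mathcal U(\mathbb Y)$ with respect to ${\bf y}_t$ is its expression in $\mathbb Z[y_{1;t}^{\pm1},\ldots,y_{n;t}^{\pm1}]$. *)

theory Defs
  imports "HOL-Analysis.Analysis" "HOL-Library.Poly_Mapping"
begin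

text \<open>
  The rank \<open>n\<close> is the cardinality of the finite index type \<open>'n\<close>; vectors and matrices are
  those of HOL-Analysis. The ambient field is a type \<open>'a :: field_char_0\<close>. That it is a field of
  rational functions in \<open>n\<close> variables over the rationals is part of the definition of a
  \<open>Y\<close>-seed: it has a family of free generators indexed by \<open>'n\<close>.
\<close>

section \<open>Free generators and Laurent polynomials\<close>

text \<open>
  Polynomials in \<open>n\<close> variables over the rationals are the elements of the monoid algebra
  \<open>(nat ^ 'n) \<Rightarrow>\<^sub>0 rat\<close>; Laurent polynomials over the integers are those of \<open>(int ^ 'n) \<Rightarrow>\<^sub>0 int\<close>.
\<close>

definition poly_eval :: "'a::field_char_0 ^ 'n::finite \<Rightarrow> ((nat ^ 'n) \<Rightarrow>\<^sub>0 rat) \<Rightarrow> 'a" where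
  "poly_eval x p =
     (\<Sum>m \<in> Poly_Mapping.keys p. of_rat (Poly_Mapping.lookup p m) * (\<Prod>i\<in>UNIV. (x $ i) ^ (m $ i)))"

definition algebraically_independent :: "'a::field_char_0 ^ 'n::finite \<Rightarrow> bool" where
  "algebraically_independent x \<longleftrightarrow> (\<forall>p. poly_eval x p = 0 \<longrightarrow> p = 0)"

definition is_subfield :: "'a::field set \<Rightarrow> bool" where
  "is_subfield K \<longleftrightarrow> 0 \<in> K \<and> 1 \<in> K \<and> (\<forall>a\<in>K. \<forall>b\<in>K. a + b \<in> K \<and> a * b \<in> K) \<and>
     (\<forall>a\<in>K. - a \<in> K \<and> inverse a \<in> K)"

text \<open>Every subfield contains the prime field, so the subfield generated by the \<open>x $ i\<close> is the
  field generated by them over the rationals.\<close>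

definition free_generators :: "'a::field_char_0 ^ 'n::finite \<Rightarrow> bool" where
  "free_generators x \<longleftrightarrow> algebraically_independent x \<and> is_subfield hull (range (($) x)) = UNIV"

definition laurent_monomial :: "'a::field_char_0 ^ 'n::finite \<Rightarrow> int ^ 'n \<Rightarrow> 'a" where
  "laurent_monomial x h = (\<Prod>i\<in>UNIV. (x $ i) powi (h $ i))"

definition laurent_eval :: "'a::field_char_0 ^ 'n::finite \<Rightarrow> ((int ^ 'n) \<Rightarrow>\<^sub>0 int) \<Rightarrow> 'a" where
  "laurent_eval x p =
     (\<Sum>h \<in> Poly_Mapping.keys p. of_int (Poly_Mapping.lookup p h) * laurent_monomial x h)"

definition laurent_ring :: "'a::field_char_0 ^ 'n::finite \<Rightarrow> 'a set" where
  "laurent_ring x = range (laurent_eval x)"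

text \<open>Only meaningful for free generators \<open>x\<close> and \<open>u \<in> laurent_ring x\<close>; see
  \<open>laurent_expansion_eqI\<close> below.\<close>

definition laurent_expansion :: "'a::field_char_0 ^ 'n::finite \<Rightarrow> 'a \<Rightarrow> ((int ^ 'n) \<Rightarrow>\<^sub>0 int)" where
  "laurent_expansion x u = (THE p. laurent_eval x p = u)"

lemma laurent_eval_superset:
  assumes "finite A" "Poly_Mapping.keys p \<subseteq> A"
  shows "laurent_eval x p = (\<Sum>h\<in>A. of_int (Poly_Mapping.lookup p h) * laurent_monomial x h)"
  unfolding laurent_eval_def
  by (rule sum.mono_neutral_left) (use assms in \<open>auto simp: in_keys_iff\<close>)

lemma laurent_eval_diff: "laurent_eval x (p - q) = laurent_eval x p - laurent_eval x q"
proof -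
  let ?A = "Poly_Mapping.keys p \<union> Poly_Mapping.keys q"
  have "Poly_Mapping.keys (p - q) \<subseteq> ?A"
    by (auto simp: in_keys_iff lookup_minus)
  then show ?thesis
    by (simp add: laurent_eval_superset[of ?A] lookup_minus left_diff_distrib sum_subtractf)
qed

lemma free_generators_nonzero:
  fixes x :: "'a::field_char_0 ^ 'n::finite"
  assumes "free_generators x"
  shows "x $ i \<noteq> 0"
proof
  assume xi: "x $ i = 0"
  let ?m = "(\<chi> j. if j = i then 1 else 0) :: nat ^ 'n"
  have "(\<Prod>j\<in>UNIV. (x $ j) ^ (?m $ j)) = 0"
    using xi by (intro prod_zero) (auto intro!: bexI[of _ i])
  then have "poly_eval x (Poly_Mapping.single ?m 1) = 0"
    by (simp add: poly_eval_def)
  then have "Poly_Mapping.single ?m (1::rat) = 0"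
    using assms unfolding free_generators_def algebraically_independent_def by blast
  then have "Poly_Mapping.lookup (Poly_Mapping.single ?m (1::rat)) ?m = 0"
    by (simp only: lookup_zero)
  then show False
    by simp
qed

lemma laurent_eval_eq_0:
  fixes x :: "'a::field_char_0 ^ 'n::finite"
  assumes x: "free_generators x" and p: "laurent_eval x p = 0"
  shows "p = 0"
proof -
  let ?K = "Poly_Mapping.keys p"
  obtain N :: int where N: "\<And>h i. h \<in> ?K \<Longrightarrow> - (h $ i) \<le> N"
  proof -
    let ?S = "(\<lambda>(h, i). - (h $ i)) ` (?K \<times> (UNIV :: 'n set))"
    have "finite ?S" by simp
    then have "\<And>h i. h \<in> ?K \<Longrightarrow> - (h $ i) \<le> Max ?S"
      by (intro Max_ge) (auto intro!: rev_image_eqI)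
    then show thesis by (rule that)
  qed
  define s where "s h = (\<chi> i. nat (h $ i + N))" for h :: "int ^ 'n"
  have sN: "int (s h $ i) = h $ i + N" if "h \<in> ?K" for h i
    using N[OF that, of i] by (simp add: s_def)
  have inj: "inj_on s ?K"
  proof (rule inj_onI)
    fix h g assume h: "h \<in> ?K" and g: "g \<in> ?K" and eq: "s h = s g"
    have "h $ i = g $ i" for i
      using sN[OF h, of i] sN[OF g, of i] eq by simp
    then show "h = g" by (simp add: vec_eq_iff)
  qed
  define q :: "(nat ^ 'n) \<Rightarrow>\<^sub>0 rat" where
    "q = (\<Sum>h\<in>?K. Poly_Mapping.single (s h) (of_int (Poly_Mapping.lookup p h)))"
  have q: "Poly_Mapping.lookup q (s h) = of_int (Poly_Mapping.lookup p h)" if "h \<in> ?K" for h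
  proof -
    have "Poly_Mapping.lookup q (s h) =
        (\<Sum>g\<in>?K. if g = h then of_int (Poly_Mapping.lookup p g) else 0)"
      unfolding q_def lookup_sum using that inj
      by (intro sum.cong) (auto simp: lookup_single when_def inj_on_def)
    also have "\<dots> = of_int (Poly_Mapping.lookup p h)"
      using that by simp
    finally show ?thesis .
  qed
  have keysq: "Poly_Mapping.keys q \<subseteq> s ` ?K"
    unfolding q_def by (rule order_trans[OF keys_sum]) (auto split: if_splits)
  have "poly_eval x q =
      (\<Sum>m\<in>s ` ?K. of_rat (Poly_Mapping.lookup q m) * (\<Prod>i\<in>UNIV. (x $ i) ^ (m $ i)))"
    unfolding poly_eval_def
    by (rule sum.mono_neutral_left) (use keysq in \<open>auto simp: in_keys_iff\<close>)
  also have "\<dots> = (\<Sum>h\<in>?K. of_int (Poly_Mapping.lookup p h) * (\<Prod>i\<in>UNIV. (x $ i) ^ (s h $ i)))"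
    by (simp add: sum.reindex[OF inj] q)
  also have "\<dots> = (\<Sum>h\<in>?K. of_int (Poly_Mapping.lookup p h) * laurent_monomial x h *
      (\<Prod>i\<in>UNIV. (x $ i) powi N))"
  proof (rule sum.cong[OF refl])
    fix h assume h: "h \<in> ?K"
    have "(x $ i) ^ (s h $ i) = (x $ i) powi (h $ i) * (x $ i) powi N" for i
      using free_generators_nonzero[OF x, of i] sN[OF h, of i]
      by (metis power_int_add power_int_of_nat)
    then show "of_int (Poly_Mapping.lookup p h) * (\<Prod>i\<in>UNIV. (x $ i) ^ (s h $ i)) =
      of_int (Poly_Mapping.lookup p h) * laurent_monomial x h * (\<Prod>i\<in>UNIV. (x $ i) powi N)"
      by (simp add: laurent_monomial_def prod.distrib)
  qed
  also have "\<dots> = laurent_eval x p * (\<Prod>i\<in>UNIV. (x $ i) powi N)"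
    by (simp add: laurent_eval_def sum_distrib_right)
  finally have "poly_eval x q = 0"
    using p by simp
  then have "q = 0"
    using x unfolding free_generators_def algebraically_independent_def by blast
  then have "Poly_Mapping.lookup p h = 0" for h
    using q[of h] by (cases "h \<in> ?K") (auto simp: in_keys_iff)
  then show ?thesis by (intro poly_mapping_eqI) simp
qed

lemma laurent_expansion_eqI:
  assumes "free_generators x" "laurent_eval x p = u"
  shows "laurent_expansion x u = p"
  unfolding laurent_expansion_def
proof (rule the_equality)
  fix q assume "laurent_eval x q = u"
  then have "laurent_eval x (q - p) = 0"
    using assms by (simp add: laurent_eval_diff)
  then show "q = p"
    using laurent_eval_eq_0[OF assms(1)] by fastforce
qed (fact assms)

interpretation int_mod: module "\<lambda>(c::int) (v::'a::field_char_0). of_int c * v"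
  by unfold_locales (auto simp: algebra_simps)


section \<open>Mutation\<close>

definition skew_symmetrizable :: "int ^ 'n ^ 'n::finite \<Rightarrow> bool" where
  "skew_symmetrizable B \<longleftrightarrow> (\<exists>D :: int ^ 'n ^ 'n.
     (\<forall>i j. i \<noteq> j \<longrightarrow> D $ i $ j = 0) \<and> (\<forall>i. D $ i $ i > 0) \<and>
     transpose (D ** B) = - (D ** B))"

definition matrix_mutation :: "'n \<Rightarrow> int ^ 'n ^ 'n::finite \<Rightarrow> int ^ 'n ^ 'n" where
  "matrix_mutation k B = (\<chi> i j.
     if i = k \<or> j = k then - (B $ i $ j)
     else B $ i $ j + max (B $ i $ k) 0 * max (B $ k $ j) 0
                    - max (- (B $ i $ k)) 0 * max (- (B $ k $ j)) 0)"

type_synonym ('a, 'n) Y_seed = "('a ^ 'n) \<times> (int ^ 'n ^ 'n)"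

definition is_Y_seed :: "('a::field_char_0, 'n::finite) Y_seed \<Rightarrow> bool" where
  "is_Y_seed S \<longleftrightarrow> free_generators (fst S) \<and> skew_symmetrizable (snd S)"

definition Y_mutation ::
  "'n \<Rightarrow> ('a::field_char_0, 'n::finite) Y_seed \<Rightarrow> ('a, 'n) Y_seed" where
  "Y_mutation k S = (case S of (y, B) \<Rightarrow>
     ((\<chi> i. if i = k then inverse (y $ k)
            else y $ i * (y $ k) powi (max (B $ k $ i) 0) * (1 + y $ k) powi (- (B $ k $ i))),
      matrix_mutation k B))"


section \<open>The labeled regular tree and positive Y-spaces\<close>

text \<open>\<open>E s k t\<close> means that \<open>s\<close> and \<open>t\<close> are joined by an edge labeled \<open>k\<close>. The vertices are all
  elements of the type \<open>'t\<close>.\<close>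

definition is_path :: "('t \<Rightarrow> 'n \<Rightarrow> 't \<Rightarrow> bool) \<Rightarrow> 't \<Rightarrow> 't \<Rightarrow> 't list \<Rightarrow> bool" where
  "is_path E s t p \<longleftrightarrow> p \<noteq> [] \<and> hd p = s \<and> last p = t \<and> distinct p \<and>
     successively (\<lambda>u v. \<exists>k. E u k v) p"

text \<open>The first three conditions say that \<open>E\<close> is a simple graph each of whose edges carries one
  label, the fourth that the edges at a vertex correspond bijectively to the labels (which gives
  \<open>n\<close>-regularity), and the last that the graph is a tree.\<close>

definition labeled_regular_tree :: "('t \<Rightarrow> 'n::finite \<Rightarrow> 't \<Rightarrow> bool) \<Rightarrow> bool" where
  "labeled_regular_tree E \<longleftrightarrow>
     (\<forall>s k t. E s k t \<longrightarrow> E t k s) \<and>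
     (\<forall>s k. \<not> E s k s) \<and>
     (\<forall>s k l t. E s k t \<longrightarrow> E s l t \<longrightarrow> k = l) \<and>
     (\<forall>s k. \<exists>!t. E s k t) \<and>
     (\<forall>s t. \<exists>!p. is_path E s t p)"

definition Y_pattern ::
  "('t \<Rightarrow> 'n::finite \<Rightarrow> 't \<Rightarrow> bool) \<Rightarrow> ('t \<Rightarrow> ('a::field_char_0, 'n) Y_seed) \<Rightarrow> bool" where
  "Y_pattern E S \<longleftrightarrow> (\<forall>t. is_Y_seed (S t)) \<and>
     (\<forall>s k t. E s k t \<longrightarrow> S t = Y_mutation k (S s))"

text \<open>A positive \<open>Y\<close>-space is given by its family \<open>y\<close> of \<open>Y\<close>-clusters; the field is the type
  \<open>'a\<close>.\<close>

definition coordinate_algebra :: "('t \<Rightarrow> 'a::field_char_0 ^ 'n::finite) \<Rightarrow> 'a set" where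
  "coordinate_algebra y = (\<Inter>t. laurent_ring (y t))"

definition global_monomials_in :: "('t \<Rightarrow> 'a::field_char_0 ^ 'n::finite) \<Rightarrow> 't \<Rightarrow> 'a set" where
  "global_monomials_in y t =
     {laurent_monomial (y t) h | h. laurent_monomial (y t) h \<in> coordinate_algebra y}"

definition global_monomials :: "('t \<Rightarrow> 'a::field_char_0 ^ 'n::finite) \<Rightarrow> 'a set" where
  "global_monomials y = {u \<in> coordinate_algebra y. \<exists>t h. u = laurent_monomial (y t) h}"

end

theory Submission
  imports Defs
begin

text \<open>
  A homomorphism \<open>v\<close> from the semifield of subtraction-free elements (which is the same for all
  clusters) to the max-plus integers takes arbitrary prescribed values on any given cluster. If
  \<open>u\<close> is subtraction-free and Laurent in a cluster, then \<open>v u\<close> is the maximum of \<open>v\<close> over the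
  monomials in the expansion of \<open>u\<close>, because leading forms multiply. Suppose that the global
  monomial \<open>p = y\<^sub>0\<^sup>g\<close> appears in the expansion of the global monomial \<open>u = y\<^sup>h\<close>. Then
  \<open>v u \<ge> v p\<close> for every \<open>v\<close>. Expanding \<open>p\<close> in the cluster \<open>y\<close>, where the values of \<open>v\<close> are
  arbitrary, we find that no monomial other than \<open>y\<^sup>h\<close> can appear, so \<open>p\<close> is an integer multiple
  of \<open>u\<close>, hence equal to \<open>u\<close>. For linear independence, compare the coefficients of one of the
  monomials in its own cluster.
\<close>

section \<open>Evaluation of Laurent polynomials\<close>

text \<open>As a rewrite rule this loops with \<open>of_int_mult\<close> and \<open>mult.assoc\<close>.\<close>
declare int_mod.scale_scale [simp del]

lemma laurent_eval_zero [simp]: "laurent_eval x 0 = 0"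
  by (simp add: laurent_eval_def)

lemma laurent_eval_single [simp]:
  "laurent_eval x (Poly_Mapping.single h c) = of_int c * laurent_monomial x h"
  by (simp add: laurent_eval_def)

lemma laurent_eval_add: "laurent_eval x (p + q) = laurent_eval x p + laurent_eval x q"
  using laurent_eval_diff[of x "p + q" q] by simp

lemma laurent_eval_sum: "laurent_eval x (\<Sum>a\<in>A. f a) = (\<Sum>a\<in>A. laurent_eval x (f a))"
  by (induction A rule: infinite_finite_induct) (simp_all add: laurent_eval_add)

lemma laurent_eval_frag_cmul: "laurent_eval x (frag_cmul c p) = of_int c * laurent_eval x p"
proof -
  have "laurent_eval x (frag_cmul c p) = (\<Sum>h\<in>Poly_Mapping.keys p.
      of_int (Poly_Mapping.lookup (frag_cmul c p) h) * laurent_monomial x h)"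
    by (rule laurent_eval_superset[OF finite_keys keys_cmul])
  also have "\<dots> = of_int c * laurent_eval x p"
    unfolding laurent_eval_def sum_distrib_left by (rule sum.cong) (simp_all add: mult.assoc)
  finally show ?thesis .
qed

lemma laurent_monomial_zero [simp]: "laurent_monomial x 0 = 1"
  by (simp add: laurent_monomial_def)

lemma laurent_monomial_add:
  assumes "free_generators x"
  shows "laurent_monomial x (g + h) = laurent_monomial x g * laurent_monomial x h"
  using free_generators_nonzero[OF assms]
  by (simp add: laurent_monomial_def power_int_add prod.distrib)

lemma laurent_monomial_axis: "laurent_monomial x (axis i 1) = x $ i"
proof -
  have "laurent_monomial x (axis i 1) = (\<Prod>j\<in>UNIV. if j = i then x $ i else 1)"
    unfolding laurent_monomial_def by (rule prod.cong) (auto simp: axis_def)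
  then show ?thesis by simp
qed

lemma poly_mapping_sum_single:
  "p = (\<Sum>h\<in>Poly_Mapping.keys p. Poly_Mapping.single h (Poly_Mapping.lookup p h))"
  by (rule poly_mapping_eqI) (simp add: lookup_sum lookup_single when_def in_keys_iff)

lemma laurent_eval_mult:
  assumes "free_generators x"
  shows "laurent_eval x (p * q) = laurent_eval x p * laurent_eval x q"
proof -
  let ?s = "\<lambda>p h. Poly_Mapping.single h (Poly_Mapping.lookup p h)"
  have "p * q = (\<Sum>g\<in>Poly_Mapping.keys p. ?s p g) * (\<Sum>h\<in>Poly_Mapping.keys q. ?s q h)"
    by (intro arg_cong2[where f = "(*)"] poly_mapping_sum_single)
  also have "laurent_eval x \<dots> = laurent_eval x p * laurent_eval x q"
    by (simp add: sum_product mult_single laurent_eval_sum laurent_monomial_add[OF assms] ac_simps)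
       (simp add: laurent_eval_def sum_product ac_simps)
  finally show ?thesis .
qed

text \<open>Lets an identity in the field be read as one between formal Laurent polynomials, where
  coefficients and degrees make sense.\<close>

lemma laurent_eval_inject:
  assumes "free_generators x"
  shows "laurent_eval x p = laurent_eval x q \<longleftrightarrow> p = q"
  using laurent_expansion_eqI[OF assms] by metis

text \<open>The absence of zero divisors is pulled back from the field along the injective
  evaluation at \<open>x\<close>; hence free generators occur in a statement about formal Laurent
  polynomials.\<close>

lemma laurent_poly_mult_nonzero:
  fixes x :: "'a::field_char_0 ^ 'n::finite" and p q :: "(int ^ 'n) \<Rightarrow>\<^sub>0 int"
  assumes "free_generators x" "p \<noteq> 0" "q \<noteq> 0"
  shows "p * q \<noteq> 0"
proof -
  have "laurent_eval x (p * q) \<noteq> 0"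
    using assms laurent_eval_eq_0 by (auto simp: laurent_eval_mult)
  then show ?thesis by auto
qed


section \<open>Weighted degrees\<close>

definition weight :: "int ^ 'n \<Rightarrow> int ^ 'n::finite \<Rightarrow> int" where
  "weight w h = (\<Sum>i\<in>UNIV. w $ i * h $ i)"

lemma weight_add: "weight w (g + h) = weight w g + weight w h"
  by (simp add: weight_def distrib_left sum.distrib)

lemma weight_axis: "weight (axis i 1) h = h $ i"
proof -
  have "weight (axis i 1) h = (\<Sum>j\<in>UNIV. if j = i then h $ i else 0)"
    unfolding weight_def by (rule sum.cong) (auto simp: axis_def)
  then show ?thesis by simp
qed

lemma weight_axis': "weight w (axis i 1) = w $ i"
  using weight_axis[of i w] by (simp add: weight_def mult.commute)

text \<open>The hypothesis at \<open>w\<close> and at \<open>- w\<close> gives equal weights; the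
  unit vectors then read off the coordinates.\<close>

lemma weight_le_imp_eq:
  fixes g h :: "int ^ 'n::finite"
  assumes "\<And>w. weight w g \<le> weight w h"
  shows "g = h"
proof -
  have neg: "weight (- w) g = - weight w g" for w g :: "int ^ 'n"
    by (simp add: weight_def sum_negf)
  have "weight w g = weight w h" for w
    using assms[of w] assms[of "- w"] neg[of w g] neg[of w h] by linarith
  then show ?thesis
    by (metis weight_axis vec_eq_iff)
qed

text \<open>The support function of the Newton polytope of \<open>p\<close> in direction
  \<open>w\<close>. For \<open>p = 0\<close> it is the unspecified maximum of the empty set, so
  nonzero hypotheses accompany it.\<close>

definition wdeg :: "int ^ 'n \<Rightarrow> ((int ^ 'n::finite) \<Rightarrow>\<^sub>0 int) \<Rightarrow> int" where
  "wdeg w p = Max (weight w ` Poly_Mapping.keys p)"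

lemma wdeg_ge: "h \<in> Poly_Mapping.keys p \<Longrightarrow> weight w h \<le> wdeg w p"
  by (simp add: wdeg_def)

lemma wdeg_attained:
  assumes "p \<noteq> 0"
  obtains h where "h \<in> Poly_Mapping.keys p" "weight w h = wdeg w p"
proof -
  have "wdeg w p \<in> weight w ` Poly_Mapping.keys p"
    unfolding wdeg_def using assms by (intro Max_in) auto
  then show thesis using that by auto
qed

lemma leading_form:
  assumes "p \<noteq> 0"
  obtains q where "q \<noteq> 0"
    "\<And>h. h \<in> Poly_Mapping.keys q \<Longrightarrow> weight w h = wdeg w p"
    "\<And>h. h \<in> Poly_Mapping.keys (p - q) \<Longrightarrow> weight w h < wdeg w p"
proof -
  define q where "q = Poly_Mapping.mapp (\<lambda>h c. c when weight w h = wdeg w p) p"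
  have q: "Poly_Mapping.lookup q h =
      (if weight w h = wdeg w p then Poly_Mapping.lookup p h else 0)" for h
    by (simp add: q_def lookup_mapp when_def in_keys_iff)
  obtain g where g: "g \<in> Poly_Mapping.keys p" "weight w g = wdeg w p"
    using wdeg_attained[OF assms] .
  show thesis
  proof (rule that)
    show "q \<noteq> 0"
      using g q[of g] by (auto simp: in_keys_iff)
    show "weight w h = wdeg w p" if "h \<in> Poly_Mapping.keys q" for h
      using that by (auto simp: in_keys_iff q split: if_splits)
    show "weight w h < wdeg w p" if h: "h \<in> Poly_Mapping.keys (p - q)" for h
    proof -
      have "h \<in> Poly_Mapping.keys p" "weight w h \<noteq> wdeg w p"
        using h by (auto simp: in_keys_iff lookup_minus q split: if_splits)
      then show ?thesis using wdeg_ge[of h p w] by linarith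
    qed
  qed
qed

text \<open>Weights add under multiplication, which bounds the degree from above. Equality holds
  because the product of the two leading forms is nonzero and no term of lower weight can cancel
  it.\<close>

lemma wdeg_mult:
  fixes x :: "'a::field_char_0 ^ 'n::finite" and p q :: "(int ^ 'n) \<Rightarrow>\<^sub>0 int"
  assumes x: "free_generators x" and "p \<noteq> 0" "q \<noteq> 0"
  shows "wdeg w (p * q) = wdeg w p + wdeg w q"
proof (rule antisym)
  obtain h where h: "h \<in> Poly_Mapping.keys (p * q)" "weight w h = wdeg w (p * q)"
    using wdeg_attained[OF laurent_poly_mult_nonzero[OF assms]] .
  then obtain a b where "h = a + b" "a \<in> Poly_Mapping.keys p" "b \<in> Poly_Mapping.keys q"
    using keys_mult by blast
  then show "wdeg w (p * q) \<le> wdeg w p + wdeg w q"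
    using h(2) wdeg_ge[of a p w] wdeg_ge[of b q w] by (simp add: weight_add)
next
  obtain p' where p': "p' \<noteq> 0"
    "\<And>h. h \<in> Poly_Mapping.keys p' \<Longrightarrow> weight w h = wdeg w p"
    "\<And>h. h \<in> Poly_Mapping.keys (p - p') \<Longrightarrow> weight w h < wdeg w p"
    using leading_form[OF \<open>p \<noteq> 0\<close>] by blast
  obtain q' where q': "q' \<noteq> 0"
    "\<And>h. h \<in> Poly_Mapping.keys q' \<Longrightarrow> weight w h = wdeg w q"
    "\<And>h. h \<in> Poly_Mapping.keys (q - q') \<Longrightarrow> weight w h < wdeg w q"
    using leading_form[OF \<open>q \<noteq> 0\<close>] by blast
  obtain h where h: "h \<in> Poly_Mapping.keys (p' * q')"
    using laurent_poly_mult_nonzero[OF x p'(1) q'(1)] by (metis ex_in_conv keys_eq_empty)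
  then have wh: "weight w h = wdeg w p + wdeg w q"
    using keys_mult[of p' q'] p'(2) q'(2) by (force simp: weight_add)
  have 1: "h \<notin> Poly_Mapping.keys ((p - p') * q)"
  proof
    assume "h \<in> Poly_Mapping.keys ((p - p') * q)"
    then obtain a b where "h = a + b" "a \<in> Poly_Mapping.keys (p - p')" "b \<in> Poly_Mapping.keys q"
      using keys_mult by blast
    then show False
      using wh p'(3)[of a] wdeg_ge[of b q w] by (simp add: weight_add)
  qed
  have 2: "h \<notin> Poly_Mapping.keys (p' * (q - q'))"
  proof
    assume "h \<in> Poly_Mapping.keys (p' * (q - q'))"
    then obtain a b where "h = a + b" "a \<in> Poly_Mapping.keys p'" "b \<in> Poly_Mapping.keys (q - q')"
      using keys_mult by blast
    then show False
      using wh p'(2)[of a] q'(3)[of b] by (simp add: weight_add)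
  qed
  \<comment> \<open>In each of the last two products one factor has only terms below its top weight,
    so neither contains \<open>h\<close>, and the coefficient at \<open>h\<close> is that of
    \<open>p' * q'\<close>.\<close>
  have "p * q = p' * q' + (p - p') * q + p' * (q - q')"
    by (simp add: algebra_simps)
  then have "h \<in> Poly_Mapping.keys (p * q)"
    using h 1 2 by (simp add: in_keys_iff lookup_add)
  then show "wdeg w p + wdeg w q \<le> wdeg w (p * q)"
    using wdeg_ge[of h "p * q" w] wh by simp
qed

lemma wdeg_single: "c \<noteq> 0 \<Longrightarrow> wdeg w (Poly_Mapping.single h c) = weight w h"
  by (simp add: wdeg_def)


section \<open>Subtraction-free elements\<close>

text \<open>The semifield generated by the cluster: negation and \<open>0\<close> are left out. The
  convention \<open>inverse 0 = 0\<close> is harmless, since \<open>0\<close> never arises from free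
  generators (\<open>subtraction_free_nonzero\<close>).\<close>

inductive_set subtraction_free :: "'a::field_char_0 ^ 'n::finite \<Rightarrow> 'a set" for x where
  gen: "x $ i \<in> subtraction_free x"
| one: "1 \<in> subtraction_free x"
| add: "\<lbrakk>a \<in> subtraction_free x; b \<in> subtraction_free x\<rbrakk> \<Longrightarrow> a + b \<in> subtraction_free x"
| mult: "\<lbrakk>a \<in> subtraction_free x; b \<in> subtraction_free x\<rbrakk> \<Longrightarrow> a * b \<in> subtraction_free x"
| inv: "a \<in> subtraction_free x \<Longrightarrow> inverse a \<in> subtraction_free x"

lemma subtraction_free_powi:
  assumes "a \<in> subtraction_free x"
  shows "a powi k \<in> subtraction_free x"
proof -
  have "b ^ n \<in> subtraction_free x" if "b \<in> subtraction_free x" for b n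
    by (induction n) (auto intro: subtraction_free.intros that)
  then show ?thesis
    using assms by (auto simp: power_int_def intro: subtraction_free.inv)
qed

lemma subtraction_free_prod:
  assumes "\<And>i. i \<in> I \<Longrightarrow> f i \<in> subtraction_free x"
  shows "(\<Prod>i\<in>I. f i) \<in> subtraction_free x"
  using assms
  by (induction I rule: infinite_finite_induct) (auto intro: subtraction_free.intros)

lemma subtraction_free_monomial: "laurent_monomial x h \<in> subtraction_free x"
  unfolding laurent_monomial_def
  by (intro subtraction_free_prod subtraction_free_powi subtraction_free.gen)

lemma subtraction_free_of_pos_int: "c > 0 \<Longrightarrow> of_int c \<in> subtraction_free x"
  by (induction c rule: int_gr_induct) (auto intro: subtraction_free.intros)

section \<open>Independence of the semifield from the cluster\<close>

lemma subtraction_free_mono: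
  assumes "\<And>i. z $ i \<in> subtraction_free x"
  shows "subtraction_free z \<subseteq> subtraction_free x"
proof
  fix a assume "a \<in> subtraction_free z"
  then show "a \<in> subtraction_free x"
    by induction (auto intro: subtraction_free.intros assms)
qed

text \<open>The mutation rule only uses products, integer powers, inverses and the sum
  \<open>1 + y $ k\<close>.\<close>

lemma subtraction_free_Y_mutation:
  "subtraction_free (fst (Y_mutation k (y, B))) \<subseteq> subtraction_free y"
  by (rule subtraction_free_mono)
     (auto simp: Y_mutation_def
       intro!: subtraction_free.mult subtraction_free_powi subtraction_free.add
         subtraction_free.inv subtraction_free.gen subtraction_free.one)

lemma is_path_imp_rtranclp:
  assumes "is_path E s t p"
  shows "(\<lambda>u v. \<exists>k. E u k v)\<^sup>*\<^sup>* s t"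
proof -
  have "successively R p \<Longrightarrow> p \<noteq> [] \<Longrightarrow> R\<^sup>*\<^sup>* (hd p) (last p)" for R :: "'a \<Rightarrow> 'a \<Rightarrow> bool"
    by (induction p) (auto simp: successively_Cons intro: converse_rtranclp_into_rtranclp)
  then show ?thesis
    using assms unfolding is_path_def by blast
qed

text \<open>Inclusions along the edges of a path compose. The tree has a path in either direction
  between \<open>s\<close> and \<open>t\<close>, so both inclusions follow without showing that
  mutation is an involution.\<close>

lemma subtraction_free_cluster_eq:
  assumes E: "labeled_regular_tree E" and Y: "Y_pattern E (\<lambda>t. (y t, B t))"
  shows "subtraction_free (y s) = subtraction_free (y t)"
proof -
  have sub: "subtraction_free (y t) \<subseteq> subtraction_free (y s)" for s t
  proof -
    obtain p where "is_path E s t p"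
      using E unfolding labeled_regular_tree_def by blast
    from is_path_imp_rtranclp[OF this] show ?thesis
    proof (induction rule: rtranclp_induct)
      case (step u v)
      then obtain k where "E u k v" by blast
      then have "(y v, B v) = Y_mutation k (y u, B u)"
        using Y unfolding Y_pattern_def by blast
      then have "y v = fst (Y_mutation k (y u, B u))" by (metis fst_conv)
      then show ?case
        using step.IH subtraction_free_Y_mutation by (metis order_trans)
    qed simp
  qed
  show ?thesis by (rule antisym[OF sub sub])
qed

section \<open>Quotients of Laurent polynomials with nonnegative coefficients\<close>

definition positive_poly :: "((int ^ 'n::finite) \<Rightarrow>\<^sub>0 int) \<Rightarrow> bool" where
  "positive_poly p \<longleftrightarrow> p \<noteq> 0 \<and> (\<forall>h. 0 \<le> Poly_Mapping.lookup p h)"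

lemma positive_poly_single: "c > 0 \<Longrightarrow> positive_poly (Poly_Mapping.single h c)"
  by (auto simp: positive_poly_def lookup_single when_def poly_mapping_eq_iff fun_eq_iff)

text \<open>Nonnegative coefficients cannot cancel. This is what makes the degree of a sum exactly
  the maximum of the degrees.\<close>

lemma keys_add_positive:
  assumes "positive_poly p" "positive_poly q"
  shows "Poly_Mapping.keys (p + q) = Poly_Mapping.keys p \<union> Poly_Mapping.keys q"
  using assms by (auto simp: in_keys_iff lookup_add positive_poly_def add_nonneg_eq_0_iff)

lemma positive_poly_add:
  assumes "positive_poly p" "positive_poly q"
  shows "positive_poly (p + q)"
proof -
  have "Poly_Mapping.keys (p + q) \<noteq> {}"
    unfolding keys_add_positive[OF assms] using assms by (simp add: positive_poly_def)
  then show ?thesis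
    using assms by (simp add: positive_poly_def lookup_add)
qed

lemma wdeg_add:
  assumes "positive_poly p" "positive_poly q"
  shows "wdeg w (p + q) = max (wdeg w p) (wdeg w q)"
  using assms
  by (auto simp: wdeg_def keys_add_positive image_Un positive_poly_def intro!: Max_Un)

lemma positive_poly_mult:
  fixes x :: "'a::field_char_0 ^ 'n::finite" and p q :: "(int ^ 'n) \<Rightarrow>\<^sub>0 int"
  assumes "free_generators x" and p: "positive_poly p" and q: "positive_poly q"
  shows "positive_poly (p * q)"
proof -
  have Sum_any_nonneg: "0 \<le> Sum_any f" if "\<And>k. 0 \<le> f k" for f :: "int ^ 'n \<Rightarrow> int"
    unfolding Sum_any.expand_set using that by (simp add: sum_nonneg)
  have "0 \<le> Poly_Mapping.lookup (p * q) h" for h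
    unfolding lookup_mult
    by (intro Sum_any_nonneg mult_nonneg_nonneg)
       (use p q in \<open>auto simp: positive_poly_def when_def\<close>)
  then show ?thesis
    using assms laurent_poly_mult_nonzero[OF assms(1)] by (simp add: positive_poly_def)
qed

text \<open>Numerator and denominator are explicit arguments because they are not unique and degrees
  are computed from them; independence of the choice is shown in
  \<open>tropical_valuation_exists\<close>.\<close>

definition is_positive_fraction ::
  "'a::field_char_0 ^ 'n::finite \<Rightarrow> 'a \<Rightarrow> ((int ^ 'n) \<Rightarrow>\<^sub>0 int) \<Rightarrow> ((int ^ 'n) \<Rightarrow>\<^sub>0 int) \<Rightarrow> bool" where
  "is_positive_fraction x f p q \<longleftrightarrow>
     positive_poly p \<and> positive_poly q \<and> f = laurent_eval x p / laurent_eval x q"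

lemma is_positive_fraction_mult:
  assumes "free_generators x" "is_positive_fraction x f p q" "is_positive_fraction x g r s"
  shows "is_positive_fraction x (f * g) (p * r) (q * s)"
  using assms by (simp add: is_positive_fraction_def positive_poly_mult laurent_eval_mult)

lemma is_positive_fraction_add:
  assumes x: "free_generators x"
    and "is_positive_fraction x f p q" "is_positive_fraction x g r s"
  shows "is_positive_fraction x (f + g) (p * s + r * q) (q * s)"
proof -
  have "laurent_eval x q \<noteq> 0" "laurent_eval x s \<noteq> 0"
    using assms laurent_eval_eq_0 by (auto simp: is_positive_fraction_def positive_poly_def)
  then show ?thesis
    using assms by (simp add: is_positive_fraction_def positive_poly_mult[OF x] positive_poly_add
      laurent_eval_mult laurent_eval_add field_simps)
qed

lemma subtraction_free_imp_fraction:
  assumes x: "free_generators x" and "f \<in> subtraction_free x"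
  shows "\<exists>p q. is_positive_fraction x f p q"
  using assms(2)
proof induction
  case (gen i)
  have "is_positive_fraction x (x $ i) (Poly_Mapping.single (axis i 1) 1) (Poly_Mapping.single 0 1)"
    unfolding is_positive_fraction_def
    by (intro conjI positive_poly_single) (simp_all add: laurent_monomial_axis del: single_one)
  then show ?case by blast
next
  case one
  have "is_positive_fraction x 1 (Poly_Mapping.single 0 1) (Poly_Mapping.single 0 1)"
    unfolding is_positive_fraction_def
    by (intro conjI positive_poly_single) (simp_all del: single_one)
  then show ?case by blast
next
  case (inv a)
  then obtain p q where "is_positive_fraction x a p q" by blast
  then have "is_positive_fraction x (inverse a) q p"
    by (simp add: is_positive_fraction_def)
  then show ?case by blast
qed (use is_positive_fraction_mult[OF x] is_positive_fraction_add[OF x] in blast)+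

text \<open>Such an element is a quotient of nonzero Laurent polynomials. In particular a sum of two
  of them never vanishes, which later excludes a sign.\<close>

lemma subtraction_free_nonzero:
  assumes x: "free_generators x" and "f \<in> subtraction_free x"
  shows "f \<noteq> 0"
  using subtraction_free_imp_fraction[OF assms] laurent_eval_eq_0[OF x]
  by (auto simp: is_positive_fraction_def positive_poly_def)


section \<open>Tropical valuations\<close>

text \<open>A homomorphism to the integers under maximum and addition, so it behaves like a degree.
  On a semifield this already fixes its values at \<open>1\<close> and at inverses.\<close>

definition tropical_valuation :: "'a::semiring set \<Rightarrow> ('a \<Rightarrow> int) \<Rightarrow> bool" where
  "tropical_valuation S v \<longleftrightarrow>
     (\<forall>a\<in>S. \<forall>b\<in>S. v (a * b) = v a + v b \<and> v (a + b) = max (v a) (v b))"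

text \<open>The value is the \<open>w\<close>-degree of a numerator minus that of a denominator. The
  product rule comes from \<open>wdeg_mult\<close>, the maximum rule from positivity of the chosen
  representatives.\<close>

lemma tropical_valuation_exists:
  fixes x :: "'a::field_char_0 ^ 'n::finite"
  assumes x: "free_generators x"
  obtains v where "tropical_valuation (subtraction_free x) v" "\<And>i. v (x $ i) = w $ i"
proof -
  define v where
    "v f = (THE d. \<exists>p q. is_positive_fraction x f p q \<and> d = wdeg w p - wdeg w q)" for f
  have v: "v f = wdeg w p - wdeg w q" if pq: "is_positive_fraction x f p q" for f p q
    unfolding v_def
  proof (rule the_equality)
    fix d assume "\<exists>p q. is_positive_fraction x f p q \<and> d = wdeg w p - wdeg w q"
    then obtain r s where rs: "is_positive_fraction x f r s" "d = wdeg w r - wdeg w s" by blast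
    have nz: "p \<noteq> 0" "q \<noteq> 0" "r \<noteq> 0" "s \<noteq> 0"
      using pq rs by (auto simp: is_positive_fraction_def positive_poly_def)
    then have "laurent_eval x q \<noteq> 0" "laurent_eval x s \<noteq> 0"
      using laurent_eval_eq_0[OF x] by auto
    moreover have "laurent_eval x p / laurent_eval x q = laurent_eval x r / laurent_eval x s"
      using pq rs by (auto simp: is_positive_fraction_def)
    \<comment> \<open>Well-definedness: cross-multiplying gives an identity of formal Laurent
      polynomials, and comparing degrees equates the two differences.\<close>
    ultimately have "laurent_eval x (p * s) = laurent_eval x (r * q)"
      by (simp add: laurent_eval_mult[OF x] frac_eq_eq)
    then have "p * s = r * q"
      by (simp add: laurent_eval_inject[OF x])
    then show "d = wdeg w p - wdeg w q"
      using nz rs(2) wdeg_mult[OF x, of p s w] wdeg_mult[OF x, of r q w] by simp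
  qed (use pq in blast)
  show thesis
  proof
    show "tropical_valuation (subtraction_free x) v"
      unfolding tropical_valuation_def
    proof (intro ballI)
      fix a b assume "a \<in> subtraction_free x" "b \<in> subtraction_free x"
      then obtain p q r s where
        pq: "is_positive_fraction x a p q" and rs: "is_positive_fraction x b r s"
        using subtraction_free_imp_fraction[OF x] by metis
      have pos: "positive_poly p" "positive_poly q" "positive_poly r" "positive_poly s"
        using pq rs by (auto simp: is_positive_fraction_def)
      then have nz: "p \<noteq> 0" "q \<noteq> 0" "r \<noteq> 0" "s \<noteq> 0"
        by (auto simp: positive_poly_def)
      show "v (a * b) = v a + v b \<and> v (a + b) = max (v a) (v b)"
        using nz pos
        by (simp add: v[OF pq] v[OF rs] v[OF is_positive_fraction_mult[OF x pq rs]]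
            v[OF is_positive_fraction_add[OF x pq rs]] wdeg_mult[OF x] wdeg_add
            positive_poly_mult[OF x])
    qed
  next
    fix i
    have "is_positive_fraction x (x $ i)
        (Poly_Mapping.single (axis i 1) 1) (Poly_Mapping.single 0 1)"
      unfolding is_positive_fraction_def
      by (intro conjI positive_poly_single) (simp_all add: laurent_monomial_axis del: single_one)
    then show "v (x $ i) = w $ i"
      by (simp add: v wdeg_single weight_axis' del: single_one) (simp add: weight_def)
  qed
qed

text \<open>Here \<open>w\<close> is read off from \<open>v\<close> instead of being prescribed, so
  that the results also apply to a valuation constructed from another cluster with the same
  semifield.\<close>

context
  fixes x :: "'a::field_char_0 ^ 'n::finite" and v :: "'a \<Rightarrow> int" and w :: "int ^ 'n"
  assumes x: "free_generators x" and v: "tropical_valuation (subtraction_free x) v"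
  defines "w \<equiv> (\<chi> i. v (x $ i))"
begin

lemma trop_mult:
  "\<lbrakk>a \<in> subtraction_free x; b \<in> subtraction_free x\<rbrakk> \<Longrightarrow> v (a * b) = v a + v b"
  using v by (simp add: tropical_valuation_def)

lemma trop_add:
  "\<lbrakk>a \<in> subtraction_free x; b \<in> subtraction_free x\<rbrakk> \<Longrightarrow> v (a + b) = max (v a) (v b)"
  using v by (simp add: tropical_valuation_def)

lemma trop_one: "v 1 = 0"
  using trop_mult[of 1 1] by (simp add: subtraction_free.one)

lemma trop_inverse:
  assumes "a \<in> subtraction_free x"
  shows "v (inverse a) = - v a"
  using trop_mult[OF assms subtraction_free.inv[OF assms]] subtraction_free_nonzero[OF x assms]
  by (simp add: trop_one)

lemma trop_powi:
  assumes a: "a \<in> subtraction_free x"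
  shows "v (a powi k) = k * v a"
proof -
  have pow: "v (a ^ n) = int n * v a" for n
  proof (induction n)
    case (Suc n)
    then show ?case
      using trop_mult[OF a subtraction_free_powi[OF a, of "int n"]] by (simp add: distrib_right)
  qed (simp add: trop_one)
  show ?thesis
  proof (cases "k \<ge> 0")
    case True
    then show ?thesis using pow[of "nat k"] by (simp add: power_int_def)
  next
    case False
    then show ?thesis
      using pow[of "nat (- k)"] trop_inverse[OF subtraction_free_powi[OF a, of "- k"]]
      by (simp add: power_int_def power_inverse)
  qed
qed

lemma trop_prod:
  assumes "finite I" "\<And>i. i \<in> I \<Longrightarrow> f i \<in> subtraction_free x"
  shows "v (\<Prod>i\<in>I. f i) = (\<Sum>i\<in>I. v (f i))"
  using assms
  by (induction I rule: finite_induct)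
     (auto simp: trop_one trop_mult subtraction_free_prod)

lemma trop_monomial: "v (laurent_monomial x h) = weight w h"
  by (simp add: laurent_monomial_def trop_prod trop_powi subtraction_free_powi
      subtraction_free.gen weight_def w_def mult.commute)

lemma trop_of_pos_int: "c > 0 \<Longrightarrow> v (of_int c) = 0"
  by (induction c rule: int_gr_induct)
     (simp_all add: trop_one trop_add subtraction_free_of_pos_int subtraction_free.one)

lemma trop_sum:
  assumes "finite I" "I \<noteq> {}" "\<And>i. i \<in> I \<Longrightarrow> f i \<in> subtraction_free x"
  shows "(\<Sum>i\<in>I. f i) \<in> subtraction_free x \<and> v (\<Sum>i\<in>I. f i) = Max ((\<lambda>i. v (f i)) ` I)"
  using assms
  by (induction I rule: finite_ne_induct) (auto simp: trop_add intro: subtraction_free.add)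

text \<open>A positive integer has value 0, being a sum of ones, so each term has the weight of its
  exponent as value and the sum has the largest of these.\<close>

lemma trop_positive_poly:
  assumes "positive_poly p"
  shows "laurent_eval x p \<in> subtraction_free x" "v (laurent_eval x p) = wdeg w p"
proof -
  let ?f = "\<lambda>h. of_int (Poly_Mapping.lookup p h) * laurent_monomial x h"
  have pos: "Poly_Mapping.lookup p h > 0" if "h \<in> Poly_Mapping.keys p" for h
    using assms that unfolding positive_poly_def in_keys_iff by (metis order_less_le)
  have sf: "?f h \<in> subtraction_free x" if "h \<in> Poly_Mapping.keys p" for h
    using pos[OF that]
    by (intro subtraction_free.mult subtraction_free_of_pos_int subtraction_free_monomial)
  have vf: "v (?f h) = weight w h" if "h \<in> Poly_Mapping.keys p" for h
    using pos[OF that] by (simp add: trop_mult subtraction_free_of_pos_int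
      subtraction_free_monomial trop_of_pos_int trop_monomial)
  have "Poly_Mapping.keys p \<noteq> {}"
    using assms by (simp add: positive_poly_def)
  from trop_sum[OF finite_keys this sf]
  show "laurent_eval x p \<in> subtraction_free x" "v (laurent_eval x p) = wdeg w p"
    by (simp_all add: laurent_eval_def wdeg_def vf cong: image_cong)
qed

text \<open>A subtraction-free element may have negative coefficients in its expansion, as in
  \<open>(x^3 + 1) / (x + 1) = x^2 - x + 1\<close>, so \<open>trop_positive_poly\<close> does not
  apply to \<open>p\<close>. Clearing the denominator gives \<open>p * s = r\<close> with
  \<open>r\<close> and \<open>s\<close> positive, and additivity of degrees still yields the value
  \<open>wdeg w p\<close>.\<close>

lemma trop_ge_monomial:
  assumes p: "laurent_eval x p \<in> subtraction_free x" and h: "h \<in> Poly_Mapping.keys p"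
  shows "v (laurent_monomial x h) \<le> v (laurent_eval x p)"
proof -
  obtain r s where rs: "positive_poly r" "positive_poly s"
    "laurent_eval x p = laurent_eval x r / laurent_eval x s"
    using subtraction_free_imp_fraction[OF x p] by (auto simp: is_positive_fraction_def)
  have nz: "p \<noteq> 0" "s \<noteq> 0"
    using h rs by (auto simp: positive_poly_def)
  have "laurent_eval x s \<noteq> 0"
    using nz laurent_eval_eq_0[OF x] by blast
  then have "laurent_eval x (p * s) = laurent_eval x r"
    using rs by (simp add: laurent_eval_mult[OF x])
  then have "p * s = r"
    by (rule laurent_eval_inject[OF x, THEN iffD1])
  then have "wdeg w r = wdeg w p + wdeg w s"
    using nz wdeg_mult[OF x, of p s w] by simp
  then have "v (laurent_eval x p) = wdeg w p"
    using \<open>p * s = r\<close> rs(1,2) trop_mult[OF p, of "laurent_eval x s"]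
    by (auto simp: trop_positive_poly simp flip: laurent_eval_mult[OF x])
  then show ?thesis
    using wdeg_ge[OF h] by (simp add: trop_monomial)
qed

end


section \<open>Global monomials\<close>

text \<open>Stated for two systems of free generators: equality of their semifields is all that is
  needed from mutation.\<close>

lemma monomial_in_expansion_eq:
  fixes x z :: "'a::field_char_0 ^ 'n::finite"
  assumes x: "free_generators x" and z: "free_generators z"
    and sf: "subtraction_free x = subtraction_free z"
    and u: "laurent_monomial z h = laurent_eval x p"
    and g: "laurent_monomial x g = laurent_eval z q"
    and gp: "g \<in> Poly_Mapping.keys p"
  shows "laurent_monomial z h = laurent_monomial x g"
proof -
  have keys: "k = h" if k: "k \<in> Poly_Mapping.keys q" for k
  proof (rule weight_le_imp_eq)
    fix w
    \<comment> \<open>The valuation is built on \<open>z\<close>, where \<open>w\<close> can be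
      arbitrary; by \<open>sf\<close> it also controls the expansion in \<open>x\<close>. The chain
      below uses \<open>trop_ge_monomial\<close> once in each cluster.\<close>
    obtain v where v: "tropical_valuation (subtraction_free z) v" and vw: "\<And>i. v (z $ i) = w $ i"
      using tropical_valuation_exists[OF z, where w = w] by blast
    then have w: "(\<chi> i. v (z $ i)) = w"
      by (simp add: vec_eq_iff)
    have "weight w k = v (laurent_monomial z k)"
      by (simp add: trop_monomial[OF z v] w)
    also have "\<dots> \<le> v (laurent_eval z q)"
      using g k sf subtraction_free_monomial[of x g] by (intro trop_ge_monomial[OF z v]) auto
    also have "\<dots> = v (laurent_monomial x g)"
      by (simp add: g)
    also have "\<dots> \<le> v (laurent_eval x p)"
      using u gp sf v subtraction_free_monomial[of z h] by (intro trop_ge_monomial[OF x]) auto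
    also have "\<dots> = weight w h"
      using u by (simp add: trop_monomial[OF z v] w flip: u)
    finally show "weight w k \<le> weight w h" .
  qed
  define c where "c = Poly_Mapping.lookup q h"
  have "q = Poly_Mapping.single h c"
    using keys by (intro poly_mapping_eqI) (auto simp: c_def lookup_single when_def in_keys_iff)
  then have c: "laurent_monomial x g = of_int c * laurent_monomial z h"
    by (simp add: g)
  then have "laurent_eval x (frag_cmul c p) = laurent_eval x (Poly_Mapping.single g 1)"
    by (simp add: laurent_eval_frag_cmul u)
  then have "frag_cmul c p = Poly_Mapping.single g 1"
    by (rule laurent_eval_inject[OF x, THEN iffD1])
  \<comment> \<open>Coefficients at \<open>g\<close> in the cluster \<open>x\<close>: integrality of
    the expansion of \<open>u\<close> forces \<open>c\<close> to be a unit.\<close>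
  then have "c * Poly_Mapping.lookup p g = 1"
    by (metis lookup_frag_cmul lookup_single_eq)
  then have "c = 1 \<or> c = - 1"
    unfolding zmult_eq_1_iff by blast
  \<comment> \<open>This rules out \<open>c = - 1\<close>: the sum of two subtraction-free elements
    is nonzero.\<close>
  moreover have "laurent_monomial z h + laurent_monomial x g \<noteq> 0"
    using subtraction_free_nonzero[OF z subtraction_free.add[OF subtraction_free_monomial]]
      subtraction_free_monomial[of x g] sf by blast
  ultimately show ?thesis
    using c by auto
qed

text \<open>Serves both claims: the first is its contrapositive at one cluster, the second applies
  it at the cluster of each monomial in a linear relation.\<close>

lemma global_monomial_in_expansion:
  fixes E :: "'t \<Rightarrow> 'n::finite \<Rightarrow> 't \<Rightarrow> bool"
    and y :: "'t \<Rightarrow> 'a::field_char_0 ^ 'n"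
  assumes E: "labeled_regular_tree E" and Y: "Y_pattern E (\<lambda>t. (y t, B t))"
    and u: "u \<in> global_monomials y"
    and g: "laurent_monomial (y t) g \<in> global_monomials_in y t"
    and lookup: "Poly_Mapping.lookup (laurent_expansion (y t) u) g \<noteq> 0"
  shows "u = laurent_monomial (y t) g"
proof -
  have free: "free_generators (y s)" for s
    using Y by (simp add: Y_pattern_def is_Y_seed_def)
  obtain s h where s: "u = laurent_monomial (y s) h" and "u \<in> coordinate_algebra y"
    using u by (auto simp: global_monomials_def)
  then obtain p where p: "u = laurent_eval (y t) p"
    by (auto simp: coordinate_algebra_def laurent_ring_def)
  have "laurent_monomial (y t) g \<in> coordinate_algebra y"
    using g by (auto simp: global_monomials_in_def)
  then obtain q where q: "laurent_monomial (y t) g = laurent_eval (y s) q"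
    by (auto simp: coordinate_algebra_def laurent_ring_def)
  have "laurent_expansion (y t) u = p"
    using laurent_expansion_eqI[OF free] p by metis
  then have gp: "g \<in> Poly_Mapping.keys p"
    using lookup by (simp add: in_keys_iff)
  have "laurent_monomial (y s) h = laurent_eval (y t) p"
    using s p by simp
  from monomial_in_expansion_eq[OF free free subtraction_free_cluster_eq[OF E Y] this q gp]
  show ?thesis by (simp add: s)
qed

theorem corollary3p13:
  fixes E :: "'t \<Rightarrow> 'n::finite \<Rightarrow> 't \<Rightarrow> bool"
    and y :: "'t \<Rightarrow> 'a::field_char_0 ^ 'n"
    and B :: "'t \<Rightarrow> int ^ 'n ^ 'n"
    and t\<^sub>0 :: 't
  assumes "labeled_regular_tree E"
    and "Y_pattern E (\<lambda>t. (y t, B t))"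
  shows "(\<forall>u \<in> global_monomials y. u \<notin> global_monomials_in y t\<^sub>0 \<longrightarrow>
            (\<forall>h. laurent_monomial (y t\<^sub>0) h \<in> global_monomials_in y t\<^sub>0 \<longrightarrow>
              Poly_Mapping.lookup (laurent_expansion (y t\<^sub>0) u) h = 0))
       \<and> int_mod.independent (global_monomials y)"
proof
  note appears = global_monomial_in_expansion[OF assms]
  show "\<forall>u \<in> global_monomials y. u \<notin> global_monomials_in y t\<^sub>0 \<longrightarrow>
            (\<forall>h. laurent_monomial (y t\<^sub>0) h \<in> global_monomials_in y t\<^sub>0 \<longrightarrow>
              Poly_Mapping.lookup (laurent_expansion (y t\<^sub>0) u) h = 0)"
  proof (intro ballI allI impI, rule ccontr)
    fix u g
    assume "u \<in> global_monomials y" "laurent_monomial (y t\<^sub>0) g \<in> global_monomials_in y t\<^sub>0"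
      "Poly_Mapping.lookup (laurent_expansion (y t\<^sub>0) u) g \<noteq> 0"
    then have "u = laurent_monomial (y t\<^sub>0) g"
      by (rule appears)
    moreover assume "u \<notin> global_monomials_in y t\<^sub>0"
    ultimately show False
      using \<open>laurent_monomial (y t\<^sub>0) g \<in> global_monomials_in y t\<^sub>0\<close> by simp
  qed
  show "int_mod.independent (global_monomials y)"
    unfolding int_mod.independent_explicit_module
  proof (intro allI impI)
    fix T c u
    assume T: "finite T" "T \<subseteq> global_monomials y" and u: "u \<in> T"
      and sum: "(\<Sum>v\<in>T. of_int (c v) * v) = 0"
    have free: "free_generators (y s)" for s
      using assms(2) by (simp add: Y_pattern_def is_Y_seed_def)
    \<comment> \<open>The cluster is chosen to suit \<open>u\<close>, whose expansion there is a
      single term with coefficient 1.\<close>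
    obtain t h where th: "u = laurent_monomial (y t) h" and ualg: "u \<in> coordinate_algebra y"
      using u T by (auto simp: global_monomials_def)
    let ?L = "laurent_expansion (y t)"
    have L: "laurent_eval (y t) (?L v) = v" if "v \<in> T" for v
    proof -
      have "v \<in> laurent_ring (y t)"
        using that T by (auto simp: global_monomials_def coordinate_algebra_def)
      then obtain p where "v = laurent_eval (y t) p"
        by (auto simp: laurent_ring_def)
      then show ?thesis
        using laurent_expansion_eqI[OF free] by metis
    qed
    have Lu: "?L u = Poly_Mapping.single h 1"
      by (rule laurent_expansion_eqI[OF free]) (simp add: th)
    have "laurent_monomial (y t) h \<in> global_monomials_in y t"
      using th ualg by (auto simp: global_monomials_in_def)
    \<comment> \<open>Any \<open>v\<close> in \<open>T\<close> whose expansion contained this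
      exponent would equal \<open>u\<close>. Hence the coefficient of the relation at
      \<open>h\<close> is just \<open>c u\<close>.\<close>
    then have others: "Poly_Mapping.lookup (?L v) h = 0" if "v \<in> T" "v \<noteq> u" for v
      using appears[of v t h] that T(2) th by auto
    have "laurent_eval (y t) (\<Sum>v\<in>T. frag_cmul (c v) (?L v)) = 0"
      using sum L by (simp add: laurent_eval_sum laurent_eval_frag_cmul)
    then have "(\<Sum>v\<in>T. frag_cmul (c v) (?L v)) = 0"
      by (rule laurent_eval_eq_0[OF free])
    then have "0 = (\<Sum>v\<in>T. c v * Poly_Mapping.lookup (?L v) h)"
      by (metis (mono_tags, lifting) lookup_frag_cmul lookup_sum lookup_zero sum.cong)
    also have "\<dots> = (\<Sum>v\<in>T. if v = u then c u else 0)"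
      by (rule sum.cong) (auto simp: Lu others)
    also have "\<dots> = c u"
      using T(1) u by simp
    finally show "c u = 0" by simp
  qed
qed

end
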